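(* Let $\mathbb{K}=\mathbb{R}$ or $\mathbb{C}$, let $n\geq 1$, and let $\mathcal{G}$ be an abelian subgroup of $GL(n,\mathbb{K})$. Let $U$ be a $\mathcal{G}$-invariant dense open set in $\mathbb{K}^n$ such that every orbit of $\mathcal{G}$ contained in $U$ is minimal in $U$ and such that $\mathbb{K}^n-U$ is a union of at most $n$ $\mathcal{G}$-invariant vector subspaces of $\mathbb{K}^n$ of dimension $n-1$ or $n-2$ over $\mathbb{K}$. If $\mathcal{G}$ has a locally dense orbit $O$ in $\mathbb{K}^n$ and $C$ is a connected component of $U$ meeting $O$, then: i) $O$ is dense in $C$, i.e. $C\subset\overline{O}$. ii) Every orbit in $U$ meeting $C$ is dense in $C$, i.e. its closure contains $C$.
   Context: $\mathcal{G}$ acts linearly on $\mathbb{K}^n$ by $(A,v)\mapsto Av$, and the orbit of $v$ is $\mathcal{G}(v)=\{Av: A\in\mathcal{G}\}$. A subset of $\mathbb{K}^n$ is $\mathcal{G}$-invariant if it is a union of orbits. If $V$ is a $\mathcal{G}$-invariant open set, a minimal set in $V$ is a non-empty $\mathcal{G}$-invariant subset of $V$, closed in $V$, with no proper subset having these properties; an orbit $O\subset V$ is minimal in $V$ if $\overline{O}\cap V$ is a minimal set in $V$. An orbit $O$ is locally dense in $\mathbb{K}^n$ if its closure $\overline{O}$ has non-empty interior. (A set $U$ with the listed properties exists for every abelian subgroup $\mathcal{G}$ of $GL(n,\mathbb{K})$.) *)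

theory Defs
  imports "HOL-Analysis.Analysis" "HOL-Algebra.Group"
begin

definition GL :: "('a::field^'n^'n) monoid"
  where "GL = \<lparr>carrier = {A. invertible A}, mult = (**), one = mat 1\<rparr>"

lemma group_GL: "group (GL :: ('a::field^'n^'n) monoid)"
proof (rule groupI)
  fix A :: "'a^'n^'n"
  assume "A \<in> carrier GL"
  then obtain B where "A ** B = mat 1" "B ** A = mat 1"
    by (auto simp: GL_def invertible_def)
  then show "\<exists>B\<in>carrier GL. B \<otimes>\<^bsub>GL\<^esub> A = \<one>\<^bsub>GL\<^esub>"
    by (auto simp: GL_def invertible_def)
qed (simp_all add: GL_def invertible_mult matrix_mul_assoc,
     auto simp: invertible_def intro: exI[of _ "mat 1"])

definition abelian_subgroup_GL :: "('a::field^'n^'n) set \<Rightarrow> bool"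
  where "abelian_subgroup_GL G \<longleftrightarrow> subgroup G GL \<and> comm_group (GL\<lparr>carrier := G\<rparr>)"

definition orb :: "('a::field^'n^'n) set \<Rightarrow> 'a^'n \<Rightarrow> ('a^'n) set"
  where "orb G v = {A *v v | A. A \<in> G}"

definition invariant :: "('a::field^'n^'n) set \<Rightarrow> ('a^'n) set \<Rightarrow> bool"
  where "invariant G X \<longleftrightarrow> (\<exists>S. X = (\<Union>v\<in>S. orb G v))"

definition inv_closed_nonempty ::
    "('a::{field,topological_space}^'n^'n) set \<Rightarrow> ('a^'n) set \<Rightarrow> ('a^'n) set \<Rightarrow> bool"
  where "inv_closed_nonempty G V M \<longleftrightarrow>
    M \<noteq> {} \<and> M \<subseteq> V \<and> invariant G M \<and> closedin (top_of_set V) M"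

definition minimal_set ::
    "('a::{field,topological_space}^'n^'n) set \<Rightarrow> ('a^'n) set \<Rightarrow> ('a^'n) set \<Rightarrow> bool"
  where "minimal_set G V M \<longleftrightarrow>
    inv_closed_nonempty G V M \<and> (\<forall>N. N \<subset> M \<longrightarrow> \<not> inv_closed_nonempty G V N)"

definition minimal_orbit ::
    "('a::{field,topological_space}^'n^'n) set \<Rightarrow> ('a^'n) set \<Rightarrow> ('a^'n) set \<Rightarrow> bool"
  where "minimal_orbit G V Ob \<longleftrightarrow> Ob \<subseteq> V \<and> minimal_set G V (closure Ob \<inter> V)"

definition locally_dense :: "('a::topological_space) set \<Rightarrow> bool"
  where "locally_dense X \<longleftrightarrow> interior (closure X) \<noteq> {}"

(* The codimension is stated additively because subtraction on nat truncates. The family F may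
   be empty, in which case U is the whole space. Subspaces and their dimension are taken over
   'a (the scaling being *s), so over the complex numbers when 'a is complex. *)
definition minimality_domain ::
    "('a::{field,topological_space}^'n^'n) set \<Rightarrow> ('a^'n) set \<Rightarrow> bool"
  where "minimality_domain G U \<longleftrightarrow>
    invariant G U \<and> open U \<and> closure U = UNIV \<and>
    (\<forall>v. orb G v \<subseteq> U \<longrightarrow> minimal_orbit G U (orb G v)) \<and>
    (\<exists>F. finite F \<and> card F \<le> CARD('n) \<and> UNIV - U = \<Union>F \<and>
      (\<forall>H\<in>F. vec.subspace H \<and> invariant G H \<and>
        (vec.dim H + 1 = CARD('n) \<or> vec.dim H + 2 = CARD('n))))"

end

theory Submission
  imports Defs
begin

text \<open>
  The closure in \<open>U\<close> of a locally dense orbit is open in \<open>U\<close>. Let \<open>Ob \<subseteq> U\<close> be the orbit and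
  \<open>M = closure Ob \<inter> U\<close>, a minimal set. The group acts by homeomorphisms, so the interior of
  \<open>closure Ob\<close> is invariant and removing it from \<open>M\<close> leaves an invariant set closed in \<open>U\<close>. This
  set is smaller than \<open>M\<close>, because the interior is a non-empty open subset of \<open>closure Ob\<close> and
  hence contains points of \<open>Ob\<close>; by minimality it is empty. So \<open>M\<close> is open and closed in \<open>U\<close>, and
  it contains every component of \<open>U\<close> that it meets. An orbit meeting such a component lies in \<open>M\<close>,
  so by minimality its closure in \<open>U\<close> is \<open>M\<close> as well.

  The argument is the same over both fields, and is carried out over a real normed field.
\<close>

lemma subgroup_GL_one: "subgroup G GL \<Longrightarrow> mat 1 \<in> G"
  using subgroup.one_closed[of G GL] by (simp add: GL_def)

lemma subgroup_GL_mult: "subgroup G GL \<Longrightarrow> A \<in> G \<Longrightarrow> B \<in> G \<Longrightarrow> A ** B \<in> G"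
  using subgroup.m_closed[of G GL A B] by (simp add: GL_def)

lemma subgroup_GL_inverse:
  assumes "subgroup G GL" "A \<in> G"
  obtains B where "B \<in> G" "B ** A = mat 1"
proof
  show "inv\<^bsub>GL\<^esub> A \<in> G"
    using assms by (rule subgroup.m_inv_closed)
  have "A \<in> carrier GL"
    using assms by (rule subgroup.mem_carrier)
  then show "inv\<^bsub>GL\<^esub> A ** A = mat 1"
    using group.l_inv[OF group_GL, of A] by (simp add: GL_def)
qed

text \<open>
  An invariant set is defined as a union of orbits; for the topological arguments it is a set
  stable under every element of the group.
\<close>

lemma invariant_iff_stable:
  assumes G: "subgroup G GL"
  shows "invariant G X \<longleftrightarrow> (\<forall>A\<in>G. \<forall>x\<in>X. A *v x \<in> X)"
proof
  assume "invariant G X"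
  then obtain S where "X = (\<Union>v\<in>S. orb G v)"
    by (auto simp: invariant_def)
  then show "\<forall>A\<in>G. \<forall>x\<in>X. A *v x \<in> X"
    by (fastforce simp: orb_def matrix_vector_mul_assoc intro: subgroup_GL_mult[OF G])
next
  assume stable: "\<forall>A\<in>G. \<forall>x\<in>X. A *v x \<in> X"
  have "x \<in> orb G x" for x
    using subgroup_GL_one[OF G] by (force simp: orb_def)
  with stable have "X = (\<Union>v\<in>X. orb G v)"
    by (auto simp: orb_def)
  then show "invariant G X"
    unfolding invariant_def by blast
qed

lemma invariantD: "subgroup G GL \<Longrightarrow> invariant G X \<Longrightarrow> A \<in> G \<Longrightarrow> x \<in> X \<Longrightarrow> A *v x \<in> X"
  by (simp add: invariant_iff_stable)

lemma invariant_orb: "invariant G (orb G v)"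
  unfolding invariant_def by (rule exI[of _ "{v}"]) simp

lemma invariant_Diff:
  assumes G: "subgroup G GL" and X: "invariant G X" and Y: "invariant G Y"
  shows "invariant G (X - Y)"
  unfolding invariant_iff_stable[OF G]
proof (intro ballI DiffI)
  fix A x assume A: "A \<in> G" and x: "x \<in> X - Y"
  show "A *v x \<in> X"
    using invariantD[OF G X A] x by simp
  obtain B where B: "B \<in> G" "B ** A = mat 1"
    using subgroup_GL_inverse[OF G A] .
  show "A *v x \<notin> Y"
  proof
    assume "A *v x \<in> Y"
    then have "B *v (A *v x) \<in> Y"
      by (rule invariantD[OF G Y B(1)])
    with x B show False
      by (simp add: matrix_vector_mul_assoc)
  qed
qed

lemma orb_subset_invariant:
  assumes G: "subgroup G GL" and X: "invariant G X" and meet: "orb G v \<inter> X \<noteq> {}"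
  shows "orb G v \<subseteq> X"
proof -
  obtain A where A: "A \<in> G" "A *v v \<in> X"
    using meet by (auto simp: orb_def)
  obtain B where B: "B \<in> G" "B ** A = mat 1"
    using subgroup_GL_inverse[OF G A(1)] .
  have "B *v (A *v v) \<in> X"
    by (rule invariantD[OF G X B(1) A(2)])
  then have "v \<in> X"
    using B by (simp add: matrix_vector_mul_assoc)
  then show ?thesis
    using invariantD[OF G X] by (auto simp: orb_def)
qed

lemma continuous_on_matrix_vector_mult:
  fixes A :: "'a::real_normed_field^'n^'m"
  shows "continuous_on S ((*v) A)"
  unfolding matrix_vector_mult_def by (intro continuous_intros)

lemma invariant_closure:
  fixes G :: "('a::real_normed_field^'n^'n) set"
  assumes G: "subgroup G GL" and X: "invariant G X"
  shows "invariant G (closure X)"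
  unfolding invariant_iff_stable[OF G]
proof (intro ballI)
  fix A x assume A: "A \<in> G" and x: "x \<in> closure X"
  have "(*v) A ` closure X \<subseteq> closure X"
  proof (rule image_closure_subset)
    show "continuous_on (closure X) ((*v) A)"
      by (rule continuous_on_matrix_vector_mult)
    show "(*v) A ` X \<subseteq> closure X"
      using invariantD[OF G X A] closure_subset by blast
  qed simp
  with x show "A *v x \<in> closure X"
    by blast
qed

lemma invariant_interior:
  fixes G :: "('a::real_normed_field^'n^'n) set"
  assumes G: "subgroup G GL" and X: "invariant G X"
  shows "invariant G (interior X)"
  unfolding invariant_iff_stable[OF G]
proof (intro ballI)
  fix A x assume A: "A \<in> G" and x: "x \<in> interior X"
  obtain B where B: "B \<in> G" "B ** A = mat 1"
    using subgroup_GL_inverse[OF G A] .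
  \<comment> \<open>The image of the interior under \<open>A\<close> is open, being its preimage under the inverse \<open>B\<close>.\<close>
  let ?T = "(*v) B -` interior X"
  have "A ** B = mat 1"
    using B(2) by (simp add: matrix_left_right_inverse)
  then have AB_cancel: "A *v (B *v y) = y" for y
    by (simp add: matrix_vector_mul_assoc)
  show "A *v x \<in> interior X"
  proof (rule interiorI)
    show "open ?T"
      by (intro open_vimage open_interior continuous_on_matrix_vector_mult)
    show "A *v x \<in> ?T"
      using x B by (simp add: matrix_vector_mul_assoc)
    show "?T \<subseteq> X"
    proof
      fix y assume "y \<in> ?T"
      then have "B *v y \<in> X"
        using interior_subset by auto
      from invariantD[OF G X A this] show "y \<in> X"
        by (simp add: AB_cancel)
    qed
  qed
qed

text \<open>
  Minimality makes the interior of the closure all or nothing: what lies outside it would be a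
  smaller closed invariant set.
\<close>

lemma minimal_locally_dense_orbit_clopen:
  fixes G :: "('a::real_normed_field^'n^'n) set"
  assumes G: "subgroup G GL" and minimal: "minimal_orbit G U (orb G v)"
    and dense: "locally_dense (orb G v)"
  shows "closedin (top_of_set U) (closure (orb G v) \<inter> U)"
    and "openin (top_of_set U) (closure (orb G v) \<inter> U)"
proof -
  let ?I = "interior (closure (orb G v))"
  let ?M = "closure (orb G v) \<inter> U"
  have sub: "orb G v \<subseteq> U" and M: "inv_closed_nonempty G U ?M"
    and least: "\<And>N. N \<subset> ?M \<Longrightarrow> \<not> inv_closed_nonempty G U N"
    using minimal by (auto simp: minimal_orbit_def minimal_set_def)
  show closed: "closedin (top_of_set U) ?M"
    using M by (simp add: inv_closed_nonempty_def)
  have "?I \<inter> closure (orb G v) \<noteq> {}"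
    using dense interior_subset[of "closure (orb G v)"] by (auto simp: locally_dense_def)
  then have "?I \<inter> orb G v \<noteq> {}"
    by (simp add: open_Int_closure_eq_empty)
  then have smaller: "?M - ?I \<subset> ?M"
    using sub closure_subset[of "orb G v"] by blast
  have "invariant G ?M"
    using M by (simp add: inv_closed_nonempty_def)
  then have inv: "invariant G (?M - ?I)"
    by (intro invariant_Diff invariant_interior invariant_closure invariant_orb G)
  have "?M - ?I = U \<inter> (closure (orb G v) - ?I)"
    by blast
  then have "closedin (top_of_set U) (?M - ?I)"
    by (auto intro: closedin_closed_Int)
  then have "?M - ?I = {}"
    using least[OF smaller] inv smaller by (auto simp: inv_closed_nonempty_def)
  then have "?M = U \<inter> ?I"
    using interior_subset[of "closure (orb G v)"] by blast
  then show "openin (top_of_set U) ?M"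
    by (simp add: openin_open_Int)
qed

lemma orbit_dense_in_component:
  fixes G :: "('a::real_normed_field^'n^'n) set"
  assumes G: "subgroup G GL" and U: "invariant G U"
    and minimal: "\<And>w. orb G w \<subseteq> U \<Longrightarrow> minimal_orbit G U (orb G w)"
    and dense: "locally_dense (orb G v)"
    and C: "C \<in> components U" and meet: "C \<inter> orb G v \<noteq> {}"
    and w: "orb G w \<subseteq> U" "orb G w \<inter> C \<noteq> {}"
  shows "C \<subseteq> closure (orb G w)"
proof -
  let ?M = "closure (orb G v) \<inter> U"
  have CU: "C \<subseteq> U"
    using C by (rule in_components_subset)
  then have "orb G v \<subseteq> U"
    using meet by (intro orb_subset_invariant[OF G U]) blast
  then have minv: "minimal_orbit G U (orb G v)"
    by (rule minimal)
  note clopen = minimal_locally_dense_orbit_clopen[OF G minv dense]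
  have CM: "C \<subseteq> ?M"
  proof -
    have "closedin (top_of_set C) (C \<inter> ?M)" "openin (top_of_set C) (C \<inter> ?M)"
      using clopen CU by (auto simp: closedin_closed openin_open)
    moreover have "C \<inter> ?M \<noteq> {}"
      using meet CU closure_subset[of "orb G v"] by blast
    ultimately have "C \<inter> ?M = C"
      using in_components_connected[OF C] unfolding connected_clopen by blast
    then show ?thesis
      by blast
  qed
  have M: "minimal_set G U ?M" "invariant G ?M"
    using minv by (auto simp: minimal_orbit_def minimal_set_def inv_closed_nonempty_def)
  have "orb G w \<subseteq> ?M"
    using w CM by (intro orb_subset_invariant[OF G M(2)]) blast
  then have "closure (orb G w) \<inter> U \<subseteq> ?M"
    using closure_minimal[of "orb G w" "closure (orb G v)"] by auto
  moreover have "inv_closed_nonempty G U (closure (orb G w) \<inter> U)"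
    using minimal[OF w(1)] by (simp add: minimal_orbit_def minimal_set_def)
  ultimately have "closure (orb G w) \<inter> U = ?M"
    using M(1) by (auto simp: minimal_set_def)
  with CM show ?thesis
    by blast
qed

lemma minimality_domain_dense_in_component:
  fixes G :: "('a::real_normed_field^'n^'n) set"
  assumes H: "abelian_subgroup_GL G \<and> minimality_domain G U \<and>
    locally_dense (orb G v) \<and> C \<in> components U \<and> C \<inter> orb G v \<noteq> {}"
  shows "C \<subseteq> closure (orb G v) \<and>
    (\<forall>w. orb G w \<subseteq> U \<and> orb G w \<inter> C \<noteq> {} \<longrightarrow> C \<subseteq> closure (orb G w))"
proof -
  have G: "subgroup G GL"
    using H by (simp add: abelian_subgroup_GL_def)
  have U: "invariant G U" and minimal: "\<And>w. orb G w \<subseteq> U \<Longrightarrow> minimal_orbit G U (orb G w)"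
    using H by (simp_all add: minimality_domain_def)
  have all: "C \<subseteq> closure (orb G w)" if "orb G w \<subseteq> U" "orb G w \<inter> C \<noteq> {}" for w
    using orbit_dense_in_component[OF G U minimal] H that by blast
  have "orb G v \<inter> U \<noteq> {}"
    using H in_components_subset[of C U] by blast
  then have "orb G v \<subseteq> U"
    by (rule orb_subset_invariant[OF G U])
  then show ?thesis
    using all H by blast
qed

theorem corollary1p4:
  shows
    "(\<forall>(G :: (real^'n^'n) set) U v C.
        abelian_subgroup_GL G \<and> minimality_domain G U \<and>
        locally_dense (orb G v) \<and> C \<in> components U \<and> C \<inter> orb G v \<noteq> {} \<longrightarrow>
        C \<subseteq> closure (orb G v) \<and>
        (\<forall>w. orb G w \<subseteq> U \<and> orb G w \<inter> C \<noteq> {} \<longrightarrow> C \<subseteq> closure (orb G w))) \<and>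
     (\<forall>(G :: (complex^'n^'n) set) U v C.
        abelian_subgroup_GL G \<and> minimality_domain G U \<and>
        locally_dense (orb G v) \<and> C \<in> components U \<and> C \<inter> orb G v \<noteq> {} \<longrightarrow>
        C \<subseteq> closure (orb G v) \<and>
        (\<forall>w. orb G w \<subseteq> U \<and> orb G w \<inter> C \<noteq> {} \<longrightarrow> C \<subseteq> closure (orb G w)))"
  by (rule conjI; (rule allI)+; rule impI; erule minimality_domain_dense_in_component)

end
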